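(* Let $G$ be a connected graph. Then $$\lambda\big(\mathcal{LM}(G,x)\big)\geq\max\left\{\Delta(G)+1,\ \delta(G)+\sqrt{\Delta(G)}\right\},$$ and equality holds if and only if $G$ is a star.
   Context: All graphs are finite, undirected, without loops or multiple edges. $V(G)$ and $E(G)$ are the vertex and edge sets, $d_G(v)$ is the degree of $v$ in $G$, and $\Delta(G)$, $\delta(G)$ are the maximum and minimum degrees of the vertices of $G$. A star is a tree in which some vertex is adjacent to all other vertices. A matching of $G$ is a set $M\subseteq E(G)$ (possibly empty) no two distinct edges of which share an endpoint; $V(M)$ is the set of endpoints of edges in $M$. The Laplacian matching polynomial of $G$ is $$\mathcal{LM}(G,x)=\sum_{M}(-1)^{|M|}\prod_{v\in V(G)\setminus V(M)}\big(x-d_G(v)\big),$$ where $M$ ranges over all matchings of $G$. All its roots are known to be real and nonnegative. For a real-rooted polynomial $f(x)$, $\lambda(f(x))$ denotes its largest zero.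
   Formalization: The graph is assumed to have at least two vertices; for the one-vertex graph the claim is false, since its polynomial x has largest zero 0 while the stated bound is 1. *)

theory Defs
  imports "HOL-Computational_Algebra.Polynomial"
begin

text \<open>A finite simple undirected graph is given by a vertex set \<open>V\<close> and a set \<open>E\<close> of
  two-element subsets of \<open>V\<close>.\<close>

definition simple_graph :: "'a set \<Rightarrow> 'a set set \<Rightarrow> bool" where
  "simple_graph V E \<longleftrightarrow> finite V \<and> (\<forall>e\<in>E. e \<subseteq> V \<and> card e = 2)"

definition adjacency :: "'a set set \<Rightarrow> ('a \<times> 'a) set" where
  "adjacency E = {(u, v). {u, v} \<in> E}"

definition connected_graph :: "'a set \<Rightarrow> 'a set set \<Rightarrow> bool" where
  "connected_graph V E \<longleftrightarrow> V \<noteq> {} \<and> (\<forall>u\<in>V. \<forall>v\<in>V. (u, v) \<in> (adjacency E)\<^sup>*)"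

definition vdegree :: "'a set set \<Rightarrow> 'a \<Rightarrow> nat" where
  "vdegree E v = card {e \<in> E. v \<in> e}"

definition max_degree :: "'a set \<Rightarrow> 'a set set \<Rightarrow> nat" where
  "max_degree V E = Max (vdegree E ` V)"

definition min_degree :: "'a set \<Rightarrow> 'a set set \<Rightarrow> nat" where
  "min_degree V E = Min (vdegree E ` V)"

text \<open>A cycle is the cyclic list of its vertices; the closing edge joins the last vertex to
  the first one.\<close>

definition is_cycle :: "'a set set \<Rightarrow> 'a list \<Rightarrow> bool" where
  "is_cycle E p \<longleftrightarrow> 3 \<le> length p \<and> distinct p \<and>
     (\<forall>i<length p. {p ! i, p ! (Suc i mod length p)} \<in> E)"

definition is_tree :: "'a set \<Rightarrow> 'a set set \<Rightarrow> bool" where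
  "is_tree V E \<longleftrightarrow> simple_graph V E \<and> connected_graph V E \<and> (\<nexists>p. is_cycle E p)"

definition is_star :: "'a set \<Rightarrow> 'a set set \<Rightarrow> bool" where
  "is_star V E \<longleftrightarrow> is_tree V E \<and> (\<exists>c\<in>V. \<forall>v\<in>V - {c}. {c, v} \<in> E)"

definition matching :: "'a set set \<Rightarrow> 'a set set \<Rightarrow> bool" where
  "matching E M \<longleftrightarrow> M \<subseteq> E \<and> pairwise disjnt M"

text \<open>In the following, \<open>\<Union>M\<close> is the set of endpoints of the edges in \<open>M\<close>, and
  \<open>[:- d, 1:]\<close> is the linear polynomial \<open>x - d\<close>.\<close>

definition laplacian_matching_poly :: "'a set \<Rightarrow> 'a set set \<Rightarrow> real poly" where
  "laplacian_matching_poly V E =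
     (\<Sum>M | matching E M. (-1) ^ card M * (\<Prod>v\<in>V - \<Union>M. [:- real (vdegree E v), 1:]))"

text \<open>Only meaningful for a nonzero polynomial with at least one real root; otherwise the set
  of roots is infinite or empty and \<open>Max\<close> is unspecified.\<close>

definition largest_root :: "real poly \<Rightarrow> real" where
  "largest_root f = Max {x. poly f x = 0}"

end

theory Submission
  imports Defs
begin

text \<open>Write \<open>P W\<close> for the matching polynomial of the subgraph induced on \<open>W\<close>, keeping the
  vertex weights \<open>d v\<close> of the whole graph. Expanding at a vertex gives
  \<open>P W = (x - d v) P (W - v) - (\<Sum>u. P (W - v - u))\<close>, the sum ranging over the neighbours of
  \<open>v\<close> in \<open>W\<close>. It implies that positivity on a half-line \<open>[x, \<infinity>)\<close> is inherited by induced
  subgraphs. Hence for \<open>y\<close> beyond the largest root every \<open>P W\<close> is positive, so that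
  \<open>P (V - c) \<le> (y - d u) P (V - c - u)\<close>, and expanding at \<open>c\<close> gives
  \<open>(\<Sum>u. 1 / (y - d u)) < y - d c\<close>. For \<open>c\<close> of maximum degree this already fails at the
  claimed bound. If the graph is not a star, there is a path \<open>c, v, b\<close>, and keeping one term
  of the expansion at \<open>v\<close> improves the inequality by \<open>1 / ((y - d v)\<^sup>2 (y - d b))\<close>; it then
  fails also in the limit, which gives strictness.\<close>

section \<open>Matching polynomials of induced subgraphs and the vertex expansion\<close>

text \<open>The weights \<open>w\<close> do not depend on \<open>W\<close>: deleting a vertex would
  change the degrees of its neighbours, and the family has to be closed under deletion for the
  expansion and the inductions below.\<close>

definition matching_poly :: "'a set set \<Rightarrow> ('a \<Rightarrow> real) \<Rightarrow> 'a set \<Rightarrow> real poly" where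
  "matching_poly E w W =
     (\<Sum>M | matching {e \<in> E. e \<subseteq> W} M. (-1) ^ card M * (\<Prod>v\<in>W - \<Union>M. [:- w v, 1:]))"

definition neighbours :: "'a set set \<Rightarrow> 'a set \<Rightarrow> 'a \<Rightarrow> 'a set" where
  "neighbours E W v = {u \<in> W. {v, u} \<in> E}"

lemma laplacian_matching_poly_eq:
  assumes "simple_graph V E"
  shows "laplacian_matching_poly V E = matching_poly E (\<lambda>v. real (vdegree E v)) V"
proof -
  have "{e \<in> E. e \<subseteq> V} = E"
    using assms by (auto simp: simple_graph_def)
  then show ?thesis
    by (simp add: laplacian_matching_poly_def matching_poly_def)
qed

lemma matching_insert:
  "matching F (insert e M) \<longleftrightarrow> e \<in> F \<and> matching F M \<and> (\<forall>f\<in>M. f \<noteq> e \<longrightarrow> disjnt e f)"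
  by (auto simp: matching_def pairwise_insert disjnt_sym)

lemma matching_mono: "matching F M \<Longrightarrow> F \<subseteq> F' \<Longrightarrow> matching F' M"
  by (auto simp: matching_def)

lemma finite_edges: "simple_graph V E \<Longrightarrow> finite E"
  by (rule finite_subset[of _ "Pow V"]) (auto simp: simple_graph_def)

lemma finite_matchings:
  assumes "simple_graph V E"
  shows "finite {M. matching {e \<in> E. e \<subseteq> W} M}"
  by (rule finite_subset[of _ "Pow E"]) (use finite_edges[OF assms] in \<open>auto simp: matching_def\<close>)

lemma edge_neqD:
  assumes "simple_graph V E" "{v, u} \<in> E"
  shows "v \<noteq> u" "v \<in> V" "u \<in> V"
  using assms by (auto simp: simple_graph_def)

lemma edge_decomp:
  assumes "simple_graph V E" "e \<in> E" "v \<in> e"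
  obtains u where "e = {v, u}" "u \<noteq> v"
proof -
  have "card e = 2" using assms by (auto simp: simple_graph_def)
  then obtain a b where "e = {a, b}" "a \<noteq> b" by (meson card_2_iff)
  with assms(3) that show ?thesis by (metis doubleton_eq_iff insertE singletonD)
qed

text \<open>Either no edge of the matching covers \<open>v\<close>, or exactly one edge
  \<open>{v, u}\<close> does, and then all its other edges avoid both \<open>v\<close> and
  \<open>u\<close>.\<close>

lemma matchings_split:
  assumes G: "simple_graph V E" and v: "v \<in> W"
  shows "{M. matching {e \<in> E. e \<subseteq> W} M} =
    {M. matching {e \<in> E. e \<subseteq> W - {v}} M} \<union>
    (\<Union>u\<in>neighbours E W v. insert {v, u} ` {M. matching {e \<in> E. e \<subseteq> W - {v} - {u}} M})"
    (is "?L = ?A \<union> ?B")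
proof
  show "?L \<subseteq> ?A \<union> ?B"
  proof
    fix M assume "M \<in> ?L"
    then have M: "matching {e \<in> E. e \<subseteq> W} M" by simp
    show "M \<in> ?A \<union> ?B"
    proof (cases "v \<in> \<Union>M")
      case False
      then have "M \<in> ?A" using M by (auto simp: matching_def)
      then show ?thesis by simp
    next
      case True
      then obtain e where e: "e \<in> M" "v \<in> e" by blast
      with M have eE: "e \<in> E" "e \<subseteq> W" by (auto simp: matching_def)
      obtain u where u: "e = {v, u}" "u \<noteq> v" using edge_decomp[OF G eE(1) e(2)] .
      have dis: "disjnt e f" if "f \<in> M - {e}" for f
        using M e that by (auto simp: matching_def pairwise_def)
      have "matching {e \<in> E. e \<subseteq> W - {v} - {u}} (M - {e})"
        using M dis u by (fastforce simp: matching_def pairwise_def disjnt_def)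
      moreover have "M = insert {v, u} (M - {e})" using e u by blast
      moreover have "u \<in> neighbours E W v" using eE u by (auto simp: neighbours_def)
      ultimately have "M \<in> ?B" by blast
      then show ?thesis by simp
    qed
  qed
next
  have "?A \<subseteq> ?L" by (auto elim: matching_mono)
  moreover have "?B \<subseteq> ?L"
  proof
    fix M assume "M \<in> ?B"
    then obtain u M' where u: "u \<in> neighbours E W v" and M: "M = insert {v, u} M'"
      and M': "matching {e \<in> E. e \<subseteq> W - {v} - {u}} M'" by blast
    have "matching {e \<in> E. e \<subseteq> W} M'" by (rule matching_mono[OF M']) blast
    moreover have "\<forall>f\<in>M'. disjnt {v, u} f" using M' by (fastforce simp: matching_def disjnt_def)
    ultimately show "M \<in> ?L" using u v by (auto simp: M matching_insert neighbours_def)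
  qed
  ultimately show "?A \<union> ?B \<subseteq> ?L" by blast
qed

text \<open>Leaving \<open>v\<close> uncovered contributes the linear factor of \<open>v\<close>;
  covering it by an edge contributes one sign and removes both endpoints from the product.\<close>

lemma matching_poly_rec:
  assumes G: "simple_graph V E" and W: "W \<subseteq> V" and v: "v \<in> W"
  shows "matching_poly E w W = [:- w v, 1:] * matching_poly E w (W - {v})
    - (\<Sum>u\<in>neighbours E W v. matching_poly E w (W - {v} - {u}))"
proof -
  define Mt where "Mt W = {M. matching {e \<in> E. e \<subseteq> W} M}" for W
  define t where "t W M = (-1) ^ card M * (\<Prod>v\<in>W - \<Union>M. [:- w v, 1:])" for W M
  define N where "N = neighbours E W v"
  have mp: "matching_poly E w W = sum (t W) (Mt W)" for W
    by (simp add: matching_poly_def Mt_def t_def)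
  have fin: "finite (Mt W)" for W using finite_matchings[OF G] by (simp add: Mt_def)
  have finV: "finite W" using G W finite_subset by (auto simp: simple_graph_def)
  then have finN: "finite N" by (simp add: N_def neighbours_def)
  have split: "Mt W = Mt (W - {v}) \<union> (\<Union>u\<in>N. insert {v, u} ` Mt (W - {v} - {u}))"
    unfolding Mt_def N_def by (rule matchings_split[OF G v])
  have v_notin: "v \<notin> e" if "e \<in> M" "M \<in> Mt (W - {v})" for e M
    using that by (auto simp: Mt_def matching_def)
  have v_notin': "v \<notin> e" if "e \<in> M" "M \<in> Mt (W - {v} - {u})" for e M u
    using that by (auto simp: Mt_def matching_def)
  have disj1: "Mt (W - {v}) \<inter> (\<Union>u\<in>N. insert {v, u} ` Mt (W - {v} - {u})) = {}"
    using v_notin by blast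
  \<comment> \<open>Members of block \<open>i\<close> contain the edge \<open>{v, i}\<close>, and no
    matching has two edges at \<open>v\<close>.\<close>
  have disj2: "\<forall>i\<in>N. \<forall>j\<in>N. i \<noteq> j \<longrightarrow>
     insert {v, i} ` Mt (W - {v} - {i}) \<inter> insert {v, j} ` Mt (W - {v} - {j}) = {}"
  proof (intro ballI impI equals0I)
    fix i j M assume ij: "i \<noteq> j"
      and M: "M \<in> insert {v, i} ` Mt (W - {v} - {i}) \<inter> insert {v, j} ` Mt (W - {v} - {j})"
    then obtain M' where M': "M = insert {v, j} M'" "M' \<in> Mt (W - {v} - {j})" by blast
    have "{v, i} \<in> M" using M by blast
    with M' ij have "{v, i} \<in> M'" by (auto simp: doubleton_eq_iff)
    with M' v_notin' show False by blast
  qed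
  have inj: "inj_on (insert {v, u}) (Mt (W - {v} - {u}))" for u
    using v_notin' by (intro inj_onI) (metis insertI1 insert_ident)
  have A: "t W M = [:- w v, 1:] * t (W - {v}) M" if "M \<in> Mt (W - {v})" for M
  proof -
    have "W - \<Union>M = insert v (W - {v} - \<Union>M)" using v v_notin[OF _ that] by blast
    then have "(\<Prod>v\<in>W - \<Union>M. [:- w v, 1:]) = [:- w v, 1:] * (\<Prod>v\<in>W - {v} - \<Union>M. [:- w v, 1:])"
      using finV by (metis (no_types, lifting) DiffD1 DiffD2 finite_Diff prod.insert singletonI)
    then show ?thesis unfolding t_def by (simp only: mult.left_commute)
  qed
  have B: "t W (insert {v, u} M) = - t (W - {v} - {u}) M" if "M \<in> Mt (W - {v} - {u})" for M u
  proof -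
    have "finite M" using that finite_edges[OF G]
      by (auto simp: Mt_def matching_def intro: finite_subset)
    moreover have "{v, u} \<notin> M" using v_notin'[OF _ that] by blast
    moreover have "W - \<Union>(insert {v, u} M) = W - {v} - {u} - \<Union>M" by blast
    ultimately show ?thesis unfolding t_def by simp
  qed
  have "matching_poly E w W =
      sum (t W) (Mt (W - {v})) + (\<Sum>u\<in>N. sum (t W) (insert {v, u} ` Mt (W - {v} - {u})))"
    unfolding mp split using fin finN disj1 disj2
    by (subst sum.union_disjoint) (simp_all add: sum.UNION_disjoint)
  also have "sum (t W) (Mt (W - {v})) = [:- w v, 1:] * matching_poly E w (W - {v})"
    using A by (simp add: mp sum_distrib_left)
  also have "(\<Sum>u\<in>N. sum (t W) (insert {v, u} ` Mt (W - {v} - {u})))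
      = (\<Sum>u\<in>N. - matching_poly E w (W - {v} - {u}))"
    using B by (simp add: mp sum.reindex[OF inj] sum_negf)
  finally show ?thesis by (simp add: sum_negf N_def)
qed

lemma poly_matching_poly_rec:
  assumes "simple_graph V E" "W \<subseteq> V" "v \<in> W"
  shows "poly (matching_poly E w W) y = (y - w v) * poly (matching_poly E w (W - {v})) y
    - (\<Sum>u\<in>neighbours E W v. poly (matching_poly E w (W - {v} - {u})) y)"
  by (simp add: matching_poly_rec[OF assms] poly_sum algebra_simps)

lemma matching_poly_edgeless:
  assumes "\<forall>e\<in>E. \<not> e \<subseteq> W"
  shows "matching_poly E w W = (\<Prod>v\<in>W. [:- w v, 1:])"
proof -
  have "{M. matching {e \<in> E. e \<subseteq> W} M} = {{}}" using assms by (auto simp: matching_def)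
  then show ?thesis by (simp add: matching_poly_def)
qed

lemma matching_poly_empty:
  assumes "simple_graph V E"
  shows "matching_poly E w {} = 1"
  using assms matching_poly_edgeless[of E "{}" w] by (fastforce simp: simple_graph_def)

lemma matching_poly_singleton:
  assumes "simple_graph V E" "v \<in> V"
  shows "matching_poly E w {v} = [:- w v, 1:]"
proof -
  have "\<not> e \<subseteq> {v}" if "e \<in> E" for e
    using assms that by (auto simp: simple_graph_def subset_singleton_iff)
  then show ?thesis using matching_poly_edgeless[of E "{v}"] by simp
qed

section \<open>Positivity for large arguments and the largest root\<close>

text \<open>The second conjunct drives the induction: it bounds each of the at most
  \<open>card V\<close> subtracted terms by \<open>P (W - {v})\<close>, so that \<open>P W\<close>
  is at least \<open>y - w v - card V >= 1\<close> times \<open>P (W - {v})\<close>.\<close>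

lemma matching_poly_pos_large:
  assumes G: "simple_graph V E" and W: "W \<subseteq> V" and y: "\<And>v. v \<in> V \<Longrightarrow> w v + real (card V) + 1 \<le> y"
  shows "poly (matching_poly E w W) y > 0 \<and>
    (\<forall>v\<in>W. poly (matching_poly E w (W - {v})) y \<le> poly (matching_poly E w W) y)"
  using W
proof (induction "card W" arbitrary: W rule: less_induct)
  case less
  define P where "P W = poly (matching_poly E w W) y" for W
  have finV: "finite V" using G by (simp add: simple_graph_def)
  then have finW: "finite W" using less.prems finite_subset by blast
  have mono: "P (W - {v}) > 0 \<and> P (W - {v}) \<le> P W" if v: "v \<in> W" for v
  proof -
    have IH: "P (W - {v}) > 0" "\<And>u. u \<in> W - {v} \<Longrightarrow> P (W - {v} - {u}) \<le> P (W - {v})"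
      using less.hyps[OF card_Diff1_less[OF finW v]] less.prems unfolding P_def by blast+
    let ?N = "neighbours E W v"
    have N: "?N \<subseteq> W - {v}" using edge_neqD[OF G] by (auto simp: neighbours_def)
    then have "card ?N \<le> card V" using less.prems finV by (intro card_mono) auto
    have "(\<Sum>u\<in>?N. P (W - {v} - {u})) \<le> (\<Sum>u\<in>?N. P (W - {v}))"
      using N IH by (intro sum_mono) auto
    also have "\<dots> \<le> card V * P (W - {v})"
      using IH \<open>card ?N \<le> card V\<close> by (simp add: mult_right_mono)
    finally have "P W \<ge> (y - w v) * P (W - {v}) - card V * P (W - {v})"
      using poly_matching_poly_rec[OF G less.prems v, of w y] unfolding P_def by linarith
    moreover have "1 * P (W - {v}) \<le> (y - w v - card V) * P (W - {v})"
      using y[of v] v less.prems IH by (intro mult_right_mono) auto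
    ultimately show ?thesis using IH by (simp add: algebra_simps)
  qed
  show ?case
  proof (cases "W = {}")
    case True
    then show ?thesis by (simp add: matching_poly_empty[OF G])
  next
    case False
    then show ?thesis using mono unfolding P_def by (meson ex_in_conv less_le_trans)
  qed
qed

lemma matching_poly_eventually_pos:
  assumes "simple_graph V E" "W \<subseteq> V"
  shows "\<exists>B. \<forall>y\<ge>B. poly (matching_poly E w W) y > 0"
proof -
  have fin: "finite V" using assms by (simp add: simple_graph_def)
  \<comment> \<open>The sum of absolute values dominates every \<open>w v\<close> and also makes
    sense for empty \<open>V\<close>.\<close>
  let ?B = "(\<Sum>v\<in>V. \<bar>w v\<bar>) + card V + 1"
  have "w v + card V + 1 \<le> y" if "y \<ge> ?B" "v \<in> V" for y v
    using member_le_sum[of v V "\<lambda>v. \<bar>w v\<bar>"] that fin by auto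
  then show ?thesis using matching_poly_pos_large[OF assms] by blast
qed

text \<open>To the right of a nonpositive value the intermediate value theorem gives a root. Hence
  all values beyond the largest root \<open>z\<close> must be positive.\<close>

lemma largest_root_above:
  fixes p :: "real poly"
  assumes B: "\<exists>B. \<forall>y\<ge>B. poly p y > 0" and y0: "poly p y0 \<le> 0"
  obtains z where "z \<ge> y0" "poly p z = 0" "\<And>y. y > z \<Longrightarrow> poly p y > 0"
proof -
  obtain B where B: "\<And>y. y \<ge> B \<Longrightarrow> poly p y > 0" using B by blast
  have root: "\<exists>z\<ge>y. poly p z = 0" if "poly p y \<le> 0" for y
  proof -
    have "poly p (max B y) > 0" using B by simp
    with that show ?thesis
      using IVT'[of "poly p" y 0 "max B y"] by (force intro: continuous_intros simp: less_imp_le)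
  qed
  have "p \<noteq> 0" using B[of B] by auto
  then have fin: "finite {z. poly p z = 0 \<and> z \<ge> y0}"
    using poly_roots_finite[of p] by (auto elim: finite_subset[rotated])
  have ne: "{z. poly p z = 0 \<and> z \<ge> y0} \<noteq> {}" using root[OF y0] by blast
  define z where "z = Max {z. poly p z = 0 \<and> z \<ge> y0}"
  have z: "poly p z = 0 \<and> z \<ge> y0" using Max_in[OF fin ne] by (simp add: z_def)
  have "poly p y > 0" if "y > z" for y
  proof (rule ccontr)
    assume "\<not> poly p y > 0"
    then obtain z' where "z' \<ge> y" "poly p z' = 0" using root[of y] by auto
    with z that have "z' \<le> z" unfolding z_def by (intro Max_ge[OF fin]) auto
    with \<open>z' \<ge> y\<close> that show False by simp
  qed
  with z that show ?thesis by blast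
qed

text \<open>Positivity beyond \<open>z\<close> also rules out the zero polynomial, so the
  \<open>Max\<close> in \<open>largest_root\<close> is taken over a finite set.\<close>

lemma largest_root_eqI:
  assumes "poly p z = 0" "\<And>y. y > z \<Longrightarrow> poly p y > 0"
  shows "largest_root p = z"
  unfolding largest_root_def
proof (rule Max_eqI)
  have "p \<noteq> 0" using assms(2)[of "z + 1"] by auto
  then show "finite {x. poly p x = 0}" by (rule poly_roots_finite)
  show "y \<le> z" if "y \<in> {x. poly p x = 0}" for y
    using assms(2)[of y] that by (cases "y \<le> z") auto
qed (use assms in auto)

section \<open>Positivity on half-lines passes to induced subgraphs\<close>

lemma poly_nonneg_at_left_end:
  fixes p :: "real poly"
  assumes "\<And>y. y > z \<Longrightarrow> poly p y > 0"
  shows "poly p z \<ge> 0"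
proof (rule tendsto_lowerbound)
  show "(poly p \<longlongrightarrow> poly p z) (at_right z)"
    by (auto intro!: tendsto_intros)
  show "\<forall>\<^sub>F y in at_right z. 0 \<le> poly p y"
    using assms by (auto simp: eventually_at_filter less_imp_le intro!: always_eventually)
qed simp

text \<open>At the largest root of \<open>W - {v}\<close> the recursion leaves only the terms
  \<open>- P (W - {v} - {u})\<close>, which are nonpositive by induction.\<close>

lemma matching_poly_pos_delete:
  assumes G: "simple_graph V E" and "W \<subseteq> V" "v \<in> W"
    and "\<And>y. y \<ge> x \<Longrightarrow> poly (matching_poly E w W) y > 0" and "y \<ge> x"
  shows "poly (matching_poly E w (W - {v})) y > 0"
  using assms(2-)
proof (induction "card W" arbitrary: W v x y rule: less_induct)
  case less
  show ?case
  proof (rule ccontr)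
    assume "\<not> poly (matching_poly E w (W - {v})) y > 0"
    then have "poly (matching_poly E w (W - {v})) y \<le> 0" by simp
    moreover have sub: "W - {v} \<subseteq> V" using less.prems by blast
    ultimately obtain z where z: "z \<ge> y" "poly (matching_poly E w (W - {v})) z = 0"
      "\<And>y. y > z \<Longrightarrow> poly (matching_poly E w (W - {v})) y > 0"
      using largest_root_above[OF matching_poly_eventually_pos[OF G sub]] by metis
    have "finite W" using less.prems G finite_subset by (auto simp: simple_graph_def)
    then have card: "card (W - {v}) < card W" using less.prems(2) by (rule card_Diff1_less)
    \<comment> \<open>The induction hypothesis for \<open>W - {v}\<close> applies on half-lines
      starting strictly beyond \<open>z\<close>. The value at \<open>z\<close> is a limit, hence
      only nonnegative, which suffices.\<close>
    have "poly (matching_poly E w (W - {v} - {u})) z \<ge> 0" if "u \<in> neighbours E W v" for u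
    proof (rule poly_nonneg_at_left_end)
      fix y' assume y': "y' > z"
      have "u \<in> W - {v}" using that edge_neqD[OF G] by (auto simp: neighbours_def)
      then show "poly (matching_poly E w (W - {v} - {u})) y' > 0"
        using less.hyps[OF card sub, of u y' y'] z(3) y' by auto
    qed
    then have "poly (matching_poly E w W) z \<le> 0"
      using poly_matching_poly_rec[OF G less.prems(1,2), of w z] z(2) by (simp add: sum_nonneg)
    moreover have "z \<ge> x" using z less.prems by simp
    ultimately show False using less.prems(3)[of z] by simp
  qed
qed

lemma matching_poly_pos_subset:
  assumes G: "simple_graph V E" and "W \<subseteq> V" "W' \<subseteq> W"
    and pos: "\<And>y. y \<ge> x \<Longrightarrow> poly (matching_poly E w W) y > 0" and "y \<ge> x"
  shows "poly (matching_poly E w W') y > 0"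
proof -
  have fin: "finite W" using assms finite_subset by (auto simp: simple_graph_def)
  \<comment> \<open>The whole half-line stays in the induction claim because every single deletion
    asks for positivity on all of it.\<close>
  have "\<forall>y\<ge>x. poly (matching_poly E w (W - D)) y > 0" if "finite D" "D \<subseteq> W" for D
    using that
  proof (induction D rule: finite_induct)
    case empty
    then show ?case using pos by simp
  next
    case (insert d D)
    have "W - insert d D = (W - D) - {d}" by blast
    with insert matching_poly_pos_delete[OF G, of "W - D" d x w] assms(2) show ?case
      by auto
  qed
  from this[of "W - W'"] show ?thesis using fin assms by (simp add: double_diff)
qed

section \<open>The inequality obtained from a path with three vertices\<close>

text \<open>Dividing the expansion at \<open>c\<close> by \<open>P (V - {c})\<close> shows that
  \<open>y - w c\<close> exceeds the sum of the ratios
  \<open>P (V - {c} - {u}) / P (V - {c})\<close>. Each ratio is at least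
  \<open>1 / (y - w u)\<close>; for \<open>u = v\<close>, the term of \<open>b\<close> in a second
  expansion yields the extra summand.\<close>

lemma matching_poly_path_bound:
  assumes G: "simple_graph V E" and c: "c \<in> V" and v: "{c, v} \<in> E" and b: "{v, b} \<in> E" "b \<noteq> c"
    and pos: "\<And>y'. y' \<ge> y \<Longrightarrow> poly (matching_poly E w V) y' > 0"
  shows "(\<Sum>u\<in>neighbours E V c. 1 / (y - w u)) + 1 / ((y - w v)\<^sup>2 * (y - w b)) < y - w c"
proof -
  define P where "P W = poly (matching_poly E w W) y" for W
  have P_pos: "P W > 0" if "W \<subseteq> V" for W
    unfolding P_def by (rule matching_poly_pos_subset[OF G subset_refl that pos]) auto
  have w_less: "w u < y" if "u \<in> V" for u
    using P_pos[of "{u}"] that by (simp add: P_def matching_poly_singleton[OF G])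
  have finN: "finite (neighbours E W u)" if "W \<subseteq> V" for W u
    using that G finite_subset by (fastforce simp: neighbours_def simple_graph_def)
  have rec: "P W = (y - w u) * P (W - {u}) - (\<Sum>s\<in>neighbours E W u. P (W - {u} - {s}))"
    if "W \<subseteq> V" "u \<in> W" for W u
    unfolding P_def by (rule poly_matching_poly_rec[OF G that])
  have nonneg: "P (W - {u} - {s}) \<ge> 0" if "W \<subseteq> V" for W u s
    by (rule less_imp_le, rule P_pos) (use that in blast)
  have le1: "P W \<le> (y - w u) * P (W - {u})" if "W \<subseteq> V" "u \<in> W" for W u
    using rec[OF that] nonneg[OF that(1)] by (simp add: sum_nonneg)
  have le2: "P W \<le> (y - w u) * P (W - {u}) - P (W - {u} - {s})"
    if "W \<subseteq> V" "u \<in> W" "s \<in> neighbours E W u" for W u s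
    using rec[OF that(1,2)] nonneg[OF that(1)] finN[OF that(1)] that(3)
      member_le_sum[of s "neighbours E W u" "\<lambda>s. P (W - {u} - {s})"] by simp
  have vV: "v \<in> V" "v \<noteq> c" and bV: "b \<in> V" "b \<noteq> v"
    using edge_neqD[OF G v] edge_neqD[OF G b(1)] by auto
  let ?A = "P (V - {c})"
  have A: "?A > 0" by (rule P_pos) blast
  have r1: "?A * (1 / (y - w u)) \<le> P (V - {c} - {u})" if "u \<in> neighbours E V c" for u
  proof -
    have "u \<in> V - {c}" using that edge_neqD[OF G] by (auto simp: neighbours_def)
    then show ?thesis using le1[of "V - {c}" u] w_less[of u]
      by (auto simp: field_simps)
  qed
  let ?a = "y - w v" and ?b = "y - w b"
  have ab: "?a > 0" "?b > 0" using w_less vV bV by auto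
  have r2: "?A * (1 / ?a + 1 / (?a\<^sup>2 * ?b)) \<le> P (V - {c} - {v})"
  proof -
    let ?B = "P (V - {c} - {v})"
    have "b \<in> neighbours E (V - {c}) v" using b bV by (auto simp: neighbours_def)
    then have "?A \<le> ?a * ?B - P (V - {c} - {v} - {b})"
      using vV by (intro le2) auto
    moreover have "?B \<le> ?b * P (V - {c} - {v} - {b})"
      using b bV by (intro le1) auto
    then have "?B / ?b \<le> P (V - {c} - {v} - {b})" using ab by (simp add: field_simps)
    ultimately have AB: "?A \<le> ?B * (?a - 1 / ?b)" by (simp add: algebra_simps)
    \<comment> \<open>Solving for \<open>?B / ?A\<close> would give the bound
      \<open>1 / (?a - 1 / ?b)\<close>. The multiplier keeps the first two terms of its geometric
      series in \<open>1 / (?a * ?b)\<close>; their denominators vanish only when \<open>y\<close>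
      equals a weight, which permits a later passage to the limit.\<close>
    have "?A * (1 / ?a + 1 / (?a\<^sup>2 * ?b)) \<le> ?B * (?a - 1 / ?b) * (1 / ?a + 1 / (?a\<^sup>2 * ?b))"
      using AB ab by (intro mult_right_mono) auto
    also have "\<dots> = ?B * (1 - (1 / (?a * ?b))\<^sup>2)"
    proof -
      have "(p - 1 / q) * (1 / p + 1 / (p\<^sup>2 * q)) = 1 - (1 / (p * q))\<^sup>2" if "p > 0" "q > 0" for p q :: real
        using that by (simp add: field_simps power2_eq_square)
      from this[OF ab] show ?thesis by (simp only: mult.assoc)
    qed
    also have "\<dots> \<le> ?B * 1"
      using nonneg[OF subset_refl, of c v] by (intro mult_left_mono) auto
    finally show ?thesis by simp
  qed
  have vN: "v \<in> neighbours E V c" using v vV by (simp add: neighbours_def)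
  have "?A * ((\<Sum>u\<in>neighbours E V c. 1 / (y - w u)) + 1 / (?a\<^sup>2 * ?b))
      = ?A * (1 / ?a + 1 / (?a\<^sup>2 * ?b)) + (\<Sum>u\<in>neighbours E V c - {v}. ?A * (1 / (y - w u)))"
    using vN finN[OF subset_refl] by (simp add: sum.remove[of _ v] sum_distrib_left algebra_simps)
  also have "\<dots> \<le> P (V - {c} - {v}) + (\<Sum>u\<in>neighbours E V c - {v}. P (V - {c} - {u}))"
    using r1 r2 by (intro add_mono sum_mono) auto
  also have "\<dots> = (\<Sum>u\<in>neighbours E V c. P (V - {c} - {u}))"
    using vN finN[OF subset_refl] by (simp add: sum.remove[of _ v])
  also have "\<dots> < ?A * (y - w c)"
    using rec[OF subset_refl c] P_pos[of V] by (simp add: algebra_simps)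
  finally show ?thesis using A by simp
qed

section \<open>Degrees, connectivity and the recognition of stars\<close>

lemma vdegree_eq_card_neighbours:
  assumes G: "simple_graph V E"
  shows "vdegree E v = card (neighbours E V v)"
proof -
  have "{e \<in> E. v \<in> e} = (\<lambda>u. {v, u}) ` neighbours E V v"
  proof
    show "{e \<in> E. v \<in> e} \<subseteq> (\<lambda>u. {v, u}) ` neighbours E V v"
    proof
      fix e assume "e \<in> {e \<in> E. v \<in> e}"
      then have e: "e \<in> E" "v \<in> e" by auto
      obtain u where "e = {v, u}" "u \<noteq> v" using edge_decomp[OF G e] .
      with e edge_neqD[OF G] show "e \<in> (\<lambda>u. {v, u}) ` neighbours E V v"
        by (auto simp: neighbours_def)
    qed
  qed (auto simp: neighbours_def)
  moreover have "inj_on (\<lambda>u. {v, u}) (neighbours E V v)"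
    by (auto simp: inj_on_def doubleton_eq_iff)
  ultimately show ?thesis by (simp add: vdegree_def card_image)
qed

text \<open>Lets connectedness be applied by exhibiting a closed set: a vertex with all its
  neighbours, or a single isolated vertex.\<close>

lemma adjacency_rtrancl_closed:
  assumes "(a, b) \<in> (adjacency E)\<^sup>*" "a \<in> S" "\<And>s t. s \<in> S \<Longrightarrow> {s, t} \<in> E \<Longrightarrow> t \<in> S"
  shows "b \<in> S"
  using assms(1,2) by induction (use assms(3) in \<open>auto simp: adjacency_def\<close>)

text \<open>The vertex \<open>c\<close> with its neighbours is closed under adjacency, hence is
  everything, and every edge contains \<open>c\<close>. This excludes cycles, since three
  consecutive edges of a cycle have no common vertex.\<close>

lemma is_star_if_no_path:
  assumes G: "simple_graph V E" and C: "connected_graph V E" and c: "c \<in> V"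
    and np: "\<And>v b. {c, v} \<in> E \<Longrightarrow> {v, b} \<in> E \<Longrightarrow> b = c"
  shows "is_star V E"
proof -
  have adj: "v = c \<or> {c, v} \<in> E" if "v \<in> V" for v
  proof -
    have "(c, v) \<in> (adjacency E)\<^sup>*" using C c that by (simp add: connected_graph_def)
    then have "v \<in> insert c {v. {c, v} \<in> E}"
      by (rule adjacency_rtrancl_closed) (use np in blast)+
    then show ?thesis by blast
  qed
  have c_in: "s = c \<or> t = c" if "{s, t} \<in> E" for s t
    using adj[of s] np[of s t] that edge_neqD[OF G that] by blast
  have "\<not> is_cycle E p" for p
  proof
    assume "is_cycle E p"
    then have len: "3 \<le> length p" and d: "distinct p"
      and e: "\<And>i. i < length p \<Longrightarrow> {p ! i, p ! (Suc i mod length p)} \<in> E"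
      by (auto simp: is_cycle_def)
    \<comment> \<open>The position after 2 on the cycle: 0 in a triangle, 3 in a longer cycle. This
      treats the closing edge uniformly.\<close>
    define k where "k = 3 mod length p"
    have k: "k < length p" "k \<noteq> 1" "k \<noteq> 2"
      using len unfolding k_def by (cases "length p = 3"; force)+
    have "0 < length p" "1 < length p" "2 < length p" using len by auto
    from this[THEN e] len
    have "{p ! 0, p ! 1} \<in> E" "{p ! 1, p ! 2} \<in> E" "{p ! 2, p ! k} \<in> E"
      by (simp_all add: k_def numeral_eq_Suc)
    then have "p ! 0 = c \<or> p ! 1 = c" "p ! 1 = c \<or> p ! 2 = c" "p ! 2 = c \<or> p ! k = c"
      using c_in by blast+
    moreover have "p ! 0 \<noteq> p ! 2" "p ! 1 \<noteq> p ! 2" "p ! 1 \<noteq> p ! k"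
      using len k by (subst nth_eq_iff_index_eq[OF d]; linarith)+
    ultimately show False by metis
  qed
  then show ?thesis using G C adj c by (auto simp: is_star_def is_tree_def)
qed

lemma degree_le_max_degree: "finite V \<Longrightarrow> v \<in> V \<Longrightarrow> vdegree E v \<le> max_degree V E"
  by (simp add: max_degree_def)

lemma min_degree_le_degree: "finite V \<Longrightarrow> v \<in> V \<Longrightarrow> min_degree V E \<le> vdegree E v"
  by (simp add: min_degree_def)

lemma degree_pos:
  assumes G: "simple_graph V E" and C: "connected_graph V E" and "card V \<ge> 2" and v: "v \<in> V"
  shows "vdegree E v \<ge> 1"
proof -
  have fin: "finite V" using G by (simp add: simple_graph_def)
  have "\<not> card V \<le> Suc 0" using assms(3) by simp
  then obtain u where u: "u \<in> V" "u \<noteq> v"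
    using card_le_Suc0_iff_eq[OF fin] by metis
  have "neighbours E V v \<noteq> {}"
  proof
    assume N: "neighbours E V v = {}"
    have "(v, u) \<in> (adjacency E)\<^sup>*" using C u v by (simp add: connected_graph_def)
    then have "u \<in> {v}"
      by (rule adjacency_rtrancl_closed) (use N edge_neqD(3)[OF G] in \<open>auto simp: neighbours_def\<close>)
    with u show False by simp
  qed
  moreover have "finite (neighbours E V v)" using fin by (simp add: neighbours_def)
  ultimately show ?thesis using vdegree_eq_card_neighbours[OF G, of v]
    by (simp add: Suc_le_eq card_gt_0_iff)
qed

section \<open>Strict inequality for graphs that are not stars\<close>

lemma largest_root_gt_if_not_star:
  assumes G: "simple_graph V E" and C: "connected_graph V E" and card: "card V \<ge> 2"
    and ns: "\<not> is_star V E"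
  shows "max (real (max_degree V E) + 1) (real (min_degree V E) + sqrt (real (max_degree V E)))
    < largest_root (laplacian_matching_poly V E)"
proof -
  define D where "D = real (max_degree V E)"
  define \<delta> where "\<delta> = real (min_degree V E)"
  define x where "x = max (D + 1) (\<delta> + sqrt D)"
  define d where "d v = real (vdegree E v)" for v
  define N where "N c = neighbours E V c" for c
  have fin: "finite V" and ne: "V \<noteq> {}" using G C by (auto simp: simple_graph_def connected_graph_def)
  have dD: "d v \<le> D" and d\<delta>: "\<delta> \<le> d v" and d1: "1 \<le> d v" if "v \<in> V" for v
    using degree_le_max_degree[OF fin that] min_degree_le_degree[OF fin that]
      degree_pos[OF G C card that] by (auto simp: d_def D_def \<delta>_def)
  obtain c where c: "c \<in> V" "d c = D"
  proof -
    have "Max (vdegree E ` V) \<in> vdegree E ` V" using fin ne by (intro Max_in) auto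
    then show ?thesis using that by (auto simp: d_def D_def max_degree_def)
  qed
  have D1: "D \<ge> 1" using d1[of c] c by simp
  have cardN: "real (card (N c)) = D"
    using c vdegree_eq_card_neighbours[OF G, of c] by (simp add: d_def N_def)
  obtain v b where vb: "{c, v} \<in> E" "{v, b} \<in> E" "b \<noteq> c"
    using is_star_if_no_path[OF G C c(1)] ns by blast
  have vV: "v \<in> V" and bV: "b \<in> V" using edge_neqD[OF G vb(1)] edge_neqD[OF G vb(2)] by auto
  have NV: "N c \<subseteq> V" by (auto simp: N_def neighbours_def)
  have xd: "x - d u > 0" if "u \<in> V" for u using dD[OF that] by (simp add: x_def)
  have key: "x - D \<le> (\<Sum>u\<in>N c. 1 / (x - d u))"
  proof -
    \<comment> \<open>\<open>r\<close> is a common upper bound for all \<open>x - d u\<close>, so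
      the \<open>D\<close> summands contribute at least \<open>D / r\<close>. The lower bounds 1 and
      \<open>\<delta>\<close> on the degrees give \<open>r = D\<close> and \<open>r = sqrt D\<close>
      in the two cases of the maximum.\<close>
    have "\<exists>r>0. x - D \<le> D / r \<and> (\<forall>u\<in>V. x - d u \<le> r)"
    proof (cases "\<delta> + sqrt D \<le> D + 1")
      case True
      then have "x = D + 1" by (simp add: x_def)
      then show ?thesis using D1 d1 by (intro exI[of _ D]) auto
    next
      case False
      then have "x = \<delta> + sqrt D" by (simp add: x_def)
      moreover have "D / sqrt D = sqrt D" using D1 by (simp add: real_div_sqrt)
      ultimately show ?thesis using D1 d\<delta> d\<delta>[OF c(1)] c(2) by (intro exI[of _ "sqrt D"]) auto
    qed
    then obtain r where r: "r > 0" "x - D \<le> D / r" "\<And>u. u \<in> V \<Longrightarrow> x - d u \<le> r" by blast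
    have "D / r = (\<Sum>u\<in>N c. 1 / r)" using cardN by simp
    also have "\<dots> \<le> (\<Sum>u\<in>N c. 1 / (x - d u))"
      using r NV xd by (intro sum_mono divide_left_mono) (auto simp: subset_iff)
    finally show ?thesis using r by simp
  qed
  let ?p = "matching_poly E d V"
  define f where "f y = (\<Sum>u\<in>N c. 1 / (y - d u)) + 1 / ((y - d v)\<^sup>2 * (y - d b)) - (y - d c)" for y
  have "f x > 0"
  proof -
    have "1 / ((x - d v)\<^sup>2 * (x - d b)) > 0" using xd[OF vV] xd[OF bV] by simp
    with key c show ?thesis unfolding f_def by linarith
  qed
  \<comment> \<open>A nonpositive value strictly beyond \<open>x\<close> forces a root strictly
    beyond \<open>x\<close>. Its absence gives positivity only on the open half-line, so the path
    inequality reaches \<open>x\<close> as the weak limit \<open>f x \<le> 0\<close>; the extra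
    summand makes even this impossible.\<close>
  have "\<exists>y0>x. poly ?p y0 \<le> 0"
  proof (rule ccontr)
    assume "\<not> ?thesis"
    then have pos: "poly ?p y > 0" if "y > x" for y using that by (meson not_le)
    have "f y \<le> 0" if "y > x" for y
      using matching_poly_path_bound[OF G c(1) vb, of y d] pos that by (auto simp: f_def N_def)
    then have ev: "\<forall>\<^sub>F y in at_right x. f y \<le> 0"
      by (auto simp: eventually_at_filter intro!: always_eventually)
    have "(f \<longlongrightarrow> f x) (at_right x)"
      unfolding f_def using xd NV vV bV
      by (intro tendsto_intros) (fastforce simp: subset_iff)+
    then have "f x \<le> 0" using ev by (rule tendsto_upperbound) simp
    with \<open>f x > 0\<close> show False by simp
  qed
  then obtain y0 where y0: "y0 > x" "poly ?p y0 \<le> 0" by blast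
  obtain z where z: "z \<ge> y0" "poly ?p z = 0" "\<And>y. y > z \<Longrightarrow> poly ?p y > 0"
    using largest_root_above[OF matching_poly_eventually_pos[OF G subset_refl] y0(2)] by blast
  have "largest_root ?p = z" by (rule largest_root_eqI) (use z in auto)
  moreover have "laplacian_matching_poly V E = ?p"
    unfolding d_def by (rule laplacian_matching_poly_eq[OF G])
  ultimately show ?thesis using z y0 by (simp add: x_def D_def \<delta>_def)
qed

section \<open>Equality for stars\<close>

text \<open>Deleting the centre leaves isolated vertices of weight 1, so one expansion at the centre
  computes the polynomial explicitly.\<close>

lemma largest_root_star:
  assumes G: "simple_graph V E" and card: "card V \<ge> 2" and star: "is_star V E"
  shows "largest_root (laplacian_matching_poly V E)
    = max (real (max_degree V E) + 1) (real (min_degree V E) + sqrt (real (max_degree V E)))"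
proof -
  obtain c where c: "c \<in> V" and adj: "\<And>v. v \<in> V - {c} \<Longrightarrow> {c, v} \<in> E"
    and acyc: "\<And>p. \<not> is_cycle E p"
    using star by (auto simp: is_star_def is_tree_def)
  have fin: "finite V" using G by (simp add: simple_graph_def)
  have leaf: "{u, v} \<notin> E" if "u \<noteq> c" "v \<noteq> c" for u v
  proof
    assume uv: "{u, v} \<in> E"
    note e = edge_neqD[OF G uv]
    \<comment> \<open>Two adjacent leaves would form a triangle with the centre.\<close>
    have "is_cycle E [c, u, v]"
      using uv e that adj[of u] adj[of v]
      by (auto simp: is_cycle_def less_Suc_eq insert_commute)
    with acyc show False by blast
  qed
  \<comment> \<open>The number of leaves, which is the degree of the centre. For
    \<open>n = 1\<close> the graph is a single edge and the centre has degree 1 as well.\<close>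
  define n where "n = card V - 1"
  have n1: "n \<ge> 1" using card by (simp add: n_def)
  have Nc: "neighbours E V c = V - {c}"
    using adj edge_neqD[OF G] by (auto simp: neighbours_def)
  have cn: "card (V - {c}) = n" using c fin by (simp add: n_def)
  have dc: "vdegree E c = n"
    using vdegree_eq_card_neighbours[OF G, of c] Nc cn by simp
  have dl: "vdegree E v = 1" if "v \<in> V - {c}" for v
  proof -
    have "neighbours E V v = {c}"
      using that adj[OF that] leaf[of v] c by (auto simp: neighbours_def insert_commute)
    then show ?thesis using vdegree_eq_card_neighbours[OF G, of v] by simp
  qed
  have ne: "V - {c} \<noteq> {}" using cn n1 by (metis card.empty not_one_le_zero)
  have "vdegree E ` V = insert (vdegree E c) (vdegree E ` (V - {c}))" using c by blast
  also have "vdegree E ` (V - {c}) = {1}" using dl ne by auto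
  finally have img: "vdegree E ` V = {n, 1}" using dc by simp
  have maxd: "max_degree V E = n" and mind: "min_degree V E = 1"
    using n1 by (simp_all add: max_degree_def min_degree_def img)
  \<comment> \<open>As the minimum degree is 1, this makes the first of the two bounds the larger
    one.\<close>
  have "sqrt (real n) \<le> real n" using n1 by (intro real_le_lsqrt) (auto simp: power2_eq_square)
  then have rhs: "max (real (max_degree V E) + 1) (real (min_degree V E) + sqrt (real (max_degree V E)))
      = real n + 1" by (simp add: maxd mind)
  let ?d = "\<lambda>v. real (vdegree E v)"
  have noE: "\<forall>e\<in>E. \<not> e \<subseteq> W" if "W \<subseteq> V - {c}" for W
  proof (intro ballI notI)
    fix e assume e: "e \<in> E" "e \<subseteq> W"
    then have "card e = 2" using G by (auto simp: simple_graph_def)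
    then obtain u v where "e = {u, v}" by (auto simp: card_2_iff)
    with e leaf[of u v] that show False by auto
  qed
  have pow: "poly (matching_poly E ?d W) y = (y - 1) ^ card W" if "W \<subseteq> V - {c}" for W y
  proof -
    have "matching_poly E ?d W = (\<Prod>v\<in>W. [:- ?d v, 1:])"
      by (rule matching_poly_edgeless[OF noE[OF that]])
    also have "\<dots> = (\<Prod>v\<in>W. [:- 1, 1:])" using that dl by (intro prod.cong) auto
    finally show ?thesis by simp
  qed
  \<comment> \<open>After extracting \<open>(y - 1) ^ (n - 1)\<close>, the cofactor
    \<open>(y - n) * (y - 1) - n\<close> factors as \<open>y * (y - (n + 1))\<close>.\<close>
  have P: "poly (matching_poly E ?d V) y = (y - 1) ^ (n - 1) * y * (y - (real n + 1))" for y
  proof -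
    have "(\<Sum>u\<in>V - {c}. poly (matching_poly E ?d (V - {c} - {u})) y)
        = (\<Sum>u\<in>V - {c}. (y - 1) ^ (n - 1))"
      using cn fin by (intro sum.cong refl) (subst pow; auto)
    then have "poly (matching_poly E ?d V) y = (y - real n) * (y - 1) ^ n - real n * (y - 1) ^ (n - 1)"
      using poly_matching_poly_rec[OF G subset_refl c, of ?d y] pow[OF subset_refl] by (simp add: Nc cn dc)
    also have "(y - 1) ^ n = (y - 1) * (y - 1) ^ (n - 1)"
      using n1 by (cases n) auto
    finally show ?thesis by (simp add: algebra_simps)
  qed
  have "largest_root (matching_poly E ?d V) = real n + 1"
    by (rule largest_root_eqI) (use n1 in \<open>auto simp: P intro!: mult_pos_pos\<close>)
  then show ?thesis using laplacian_matching_poly_eq[OF G] rhs by simp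
qed

text \<open>The assumption \<open>card V \<ge> 2\<close> excludes the one-vertex graph, whose
  polynomial \<open>x\<close> has largest root 0 while the bound equals 1.\<close>

theorem corollary3p6:
  fixes V :: "'a set" and E :: "'a set set"
  assumes "simple_graph V E"
    and "connected_graph V E"
    and "card V \<ge> 2"
  shows "largest_root (laplacian_matching_poly V E)
           \<ge> max (real (max_degree V E) + 1) (real (min_degree V E) + sqrt (real (max_degree V E)))
       \<and> (largest_root (laplacian_matching_poly V E)
             = max (real (max_degree V E) + 1) (real (min_degree V E) + sqrt (real (max_degree V E)))
          \<longleftrightarrow> is_star V E)"
proof (cases "is_star V E")
  case True
  then show ?thesis using largest_root_star[OF assms(1,3)] by simp
next
  case False
  then show ?thesis using largest_root_gt_if_not_star[OF assms] by linarith
qed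

end
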